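(* Let $f$, $\mathbf{C}$, $\mathbf{d}$, $\mathbf{P}$ be as in the context. Consider the problem (equivalent to the primal problem) $$\min_{\mathbf{x}\in\mathbb{R}^{M_V},\,\mathbf{y}\in\mathbb{R}^{M_E}} f(\mathbf{x})+\iota_{\ker(\mathbf{I}+\mathbf{P})}(\mathbf{y})\quad\text{s.t.}\quad\mathbf{C}\mathbf{x}-\mathbf{d}=\mathbf{y}.$$ Its Lagrange dual, written as a minimisation, $$\min_{\boldsymbol{\lambda}\in\mathbb{R}^{M_E}} f^*(\mathbf{C}^T\boldsymbol{\lambda})-\mathbf{d}^T\boldsymbol{\lambda}+\iota^*_{\ker(\mathbf{I}+\mathbf{P})}(\boldsymbol{\lambda}),$$ is identical to the extended dual problem $$\min_{\boldsymbol{\lambda}\in\mathbb{R}^{M_E}} f^*(\mathbf{C}^T\boldsymbol{\lambda})-\mathbf{d}^T\boldsymbol{\lambda}+\iota_{\ker(\mathbf{I}-\mathbf{P})}(\boldsymbol{\lambda});$$ that is, $\iota^*_{\ker(\mathbf{I}+\mathbf{P})}=\iota_{\ker(\mathbf{I}-\mathbf{P})}$.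
   Context: $\Gamma_0(\mathbb{R}^n)$ is the set of closed, convex, proper functions $\mathbb{R}^n\to\mathbb{R}\cup\{+\infty\}$; $g^*(\boldsymbol{\lambda})=\sup_{\mathbf{y}}(\langle\boldsymbol{\lambda},\mathbf{y}\rangle-g(\mathbf{y}))$ is the Fenchel conjugate; $\iota_S$ is the indicator function of $S$ ($0$ on $S$, $+\infty$ elsewhere). Network setting: $\mathbf{G}(V,E)$ is an undirected graph with nodes $V=\{1,\dots,N\}$ and neighbour sets $\mathcal{N}(i)=\{j:(i,j)\in E\}$. Node $i$ has $f_i\in\Gamma_0(\mathbb{R}^{M_i})$. For each edge $(i,j)\in E$ there are matrices $\mathbf{A}_{i|j}\in\mathbb{R}^{M_{ij}\times M_i}$, $\mathbf{A}_{j|i}\in\mathbb{R}^{M_{ij}\times M_j}$ and a vector $\mathbf{b}_{ij}=\mathbf{b}_{ji}\in\mathbb{R}^{M_{ij}}$ (with $M_{ij}=M_{ji}$). The primal problem is $\min\sum_{i}f_i(\mathbf{x}_i)$ subject to $\mathbf{A}_{i|j}\mathbf{x}_i+\mathbf{A}_{j|i}\mathbf{x}_j=\mathbf{b}_{ij}$ for all $(i,j)\in E$. Set $M_V=\sum_iM_i$ and $f(\mathbf{x})=\sum_if_i(\mathbf{x}_i)$. Let $M_E=\sum_{i\in V}\sum_{j\in\mathcal{N}(i)}M_{ij}$ (sum over directed edges $i|j$), and index vectors in $\mathbb{R}^{M_E}$ by blocks $\boldsymbol{\lambda}_{i|j}\in\mathbb{R}^{M_{ij}}$, ordered first by $i$,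 then by $j$. $\mathbf{C}\in\mathbb{R}^{M_E\times M_V}$ is block diagonal with blocks $\mathbf{C}_i$, where $\mathbf{C}_i$ stacks vertically $\mathbf{A}_{i|j}$, $j\in\mathcal{N}(i)$; so $(\mathbf{C}\mathbf{x})_{i|j}=\mathbf{A}_{i|j}\mathbf{x}_i$. $\mathbf{d}\in\mathbb{R}^{M_E}$ has blocks $\mathbf{d}_{i|j}=\tfrac12\mathbf{b}_{ij}$. $\mathbf{P}$ is the symmetric permutation matrix with $(\mathbf{P}\boldsymbol{\lambda})_{i|j}=\boldsymbol{\lambda}_{j|i}$ (so $\mathbf{P}^2=\mathbf{I}$). The Lagrange dual is taken with respect to the Lagrangian $f(\mathbf{x})+\iota_{\ker(\mathbf{I}+\mathbf{P})}(\mathbf{y})-\langle\boldsymbol{\lambda},\mathbf{C}\mathbf{x}-\mathbf{d}-\mathbf{y}\rangle$, and the dual maximisation is written as minimisation of the negated dual function. *)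

theory Defs
  imports
    "HOL-Analysis.Abstract_Euclidean_Space"
    "HOL-Library.Extended_Real"
    "Jordan_Normal_Form.Matrix_Kernel"
begin

text \<open>
  The dimensions of the node and edge variables vary with the node or edge, so the space
  of real vectors of length \<open>n\<close> is rendered as \<^term>\<open>carrier_vec n :: real vec set\<close>.
  A function with values in the reals and plus infinity is an \<^typ>\<open>ereal\<close>-valued function,
  of which only the restriction to the carrier matters.
\<close>

subsection \<open>Convex analysis\<close>

text \<open>The usual topology on \<^term>\<open>carrier_vec n\<close>, transported from the library's
  \<^term>\<open>Euclidean_space n\<close>, whose points are the sequences vanishing from index \<open>n\<close> on.\<close>

definition vec_topology :: "nat \<Rightarrow> real vec topology" where
  "vec_topology n =
     pullback_topology (carrier_vec n) (\<lambda>v k. if k < n then v $ k else 0) (Euclidean_space n)"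

definition epigraph :: "nat \<Rightarrow> (real vec \<Rightarrow> ereal) \<Rightarrow> (real vec \<times> real) set" where
  "epigraph n g = {(x, r). x \<in> carrier_vec n \<and> g x \<le> ereal r}"

definition closed_fun :: "nat \<Rightarrow> (real vec \<Rightarrow> ereal) \<Rightarrow> bool" where
  "closed_fun n g \<longleftrightarrow> closedin (prod_topology (vec_topology n) euclideanreal) (epigraph n g)"

definition convex_fun :: "nat \<Rightarrow> (real vec \<Rightarrow> ereal) \<Rightarrow> bool" where
  "convex_fun n g \<longleftrightarrow>
     (\<forall>x\<in>carrier_vec n. \<forall>y\<in>carrier_vec n. \<forall>t. 0 < t \<and> t < 1 \<longrightarrow>
        g (t \<cdot>\<^sub>v x + (1 - t) \<cdot>\<^sub>v y) \<le> ereal t * g x + ereal (1 - t) * g y)"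

definition proper_fun :: "nat \<Rightarrow> (real vec \<Rightarrow> ereal) \<Rightarrow> bool" where
  "proper_fun n g \<longleftrightarrow>
     (\<forall>x\<in>carrier_vec n. g x \<noteq> -\<infinity>) \<and> (\<exists>x\<in>carrier_vec n. g x \<noteq> \<infinity>)"

definition Gamma0 :: "nat \<Rightarrow> (real vec \<Rightarrow> ereal) set" where
  "Gamma0 n = {g. closed_fun n g \<and> convex_fun n g \<and> proper_fun n g}"

definition fenchel_conj :: "nat \<Rightarrow> (real vec \<Rightarrow> ereal) \<Rightarrow> real vec \<Rightarrow> ereal" where
  "fenchel_conj n g l = (SUP y\<in>carrier_vec n. ereal (l \<bullet> y) - g y)"

definition ind_fun :: "'a set \<Rightarrow> 'a \<Rightarrow> ereal" where
  "ind_fun S x = (if x \<in> S then 0 else \<infinity>)"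

definition optimal_value :: "'a set \<Rightarrow> ('a \<Rightarrow> ereal) \<Rightarrow> ereal" where
  "optimal_value S F = (INF x\<in>S. F x)"

text \<open>Points with value plus infinity count as infeasible, hence never as solutions.\<close>

definition minimisers :: "'a set \<Rightarrow> ('a \<Rightarrow> ereal) \<Rightarrow> 'a set" where
  "minimisers S F = {x \<in> S. F x \<noteq> \<infinity> \<and> (\<forall>z\<in>S. F x \<le> F z)}"

subsection \<open>The network\<close>

text \<open>
  The nodes are \<open>1, \<dots>, N\<close>; the edge set \<open>E\<close> is a symmetric relation, so that it contains both
  directed edges \<open>(i, j)\<close> and \<open>(j, i)\<close> of an undirected edge. Node \<open>i\<close> has dimension \<open>M i\<close>,
  edge \<open>(i, j)\<close> has dimension \<open>ME i j\<close>; \<open>A i j\<close> is the matrix written with index \<open>i|j\<close>.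
\<close>

definition nbrs :: "(nat \<times> nat) set \<Rightarrow> nat \<Rightarrow> nat set" where
  "nbrs E i = {j. (i, j) \<in> E}"

definition dimV :: "nat \<Rightarrow> (nat \<Rightarrow> nat) \<Rightarrow> nat" where
  "dimV N M = (\<Sum>i\<in>{1..N}. M i)"

definition dimE :: "nat \<Rightarrow> (nat \<times> nat) set \<Rightarrow> (nat \<Rightarrow> nat \<Rightarrow> nat) \<Rightarrow> nat" where
  "dimE N E ME = (\<Sum>i\<in>{1..N}. \<Sum>j\<in>nbrs E i. ME i j)"

definition node_block :: "(nat \<Rightarrow> nat) \<Rightarrow> real vec \<Rightarrow> nat \<Rightarrow> real vec" where
  "node_block M x i = vec (M i) (\<lambda>k. x $ ((\<Sum>i'\<in>{1..<i}. M i') + k))"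

definition sep_sum ::
  "nat \<Rightarrow> (nat \<Rightarrow> nat) \<Rightarrow> (nat \<Rightarrow> real vec \<Rightarrow> ereal) \<Rightarrow> real vec \<Rightarrow> ereal" where
  "sep_sum N M fs x = (\<Sum>i\<in>{1..N}. fs i (node_block M x i))"

text \<open>Position in an edge vector at which block \<open>i|j\<close> starts: the blocks are ordered
  by \<open>i\<close> and then by \<open>j\<close>.\<close>

definition edge_offset :: "(nat \<times> nat) set \<Rightarrow> (nat \<Rightarrow> nat \<Rightarrow> nat) \<Rightarrow> nat \<Rightarrow> nat \<Rightarrow> nat" where
  "edge_offset E ME i j =
     (\<Sum>i'\<in>{1..<i}. \<Sum>j'\<in>nbrs E i'. ME i' j') + (\<Sum>j'\<in>{j' \<in> nbrs E i. j' < j}. ME i j')"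

definition C_node ::
  "(nat \<times> nat) set \<Rightarrow> (nat \<Rightarrow> nat) \<Rightarrow> (nat \<Rightarrow> nat \<Rightarrow> real mat) \<Rightarrow> nat \<Rightarrow> real mat" where
  "C_node E M A i = foldr (@\<^sub>r) (map (A i) (sorted_list_of_set (nbrs E i))) (0\<^sub>m 0 (M i))"

definition C_mat ::
  "nat \<Rightarrow> (nat \<times> nat) set \<Rightarrow> (nat \<Rightarrow> nat) \<Rightarrow> (nat \<Rightarrow> nat \<Rightarrow> real mat) \<Rightarrow> real mat" where
  "C_mat N E M A = diag_block_mat (map (C_node E M A) [1..<Suc N])"

definition d_vec ::
  "nat \<Rightarrow> (nat \<times> nat) set \<Rightarrow> (nat \<Rightarrow> nat \<Rightarrow> real vec) \<Rightarrow> real vec" where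
  "d_vec N E b = foldr (@\<^sub>v)
     [(1/2) \<cdot>\<^sub>v b i j. i \<leftarrow> [1..<Suc N], j \<leftarrow> sorted_list_of_set (nbrs E i)] (0\<^sub>v 0)"

definition P_mat :: "nat \<Rightarrow> (nat \<times> nat) set \<Rightarrow> (nat \<Rightarrow> nat \<Rightarrow> nat) \<Rightarrow> real mat" where
  "P_mat N E ME = mat (dimE N E ME) (dimE N E ME) (\<lambda>(r, c).
     if \<exists>i j k. (i, j) \<in> E \<and> k < ME i j \<and>
          r = edge_offset E ME i j + k \<and> c = edge_offset E ME j i + k
     then 1 else 0)"

subsection \<open>The optimisation problems\<close>

definition primal_feasible ::
  "nat \<Rightarrow> (nat \<times> nat) set \<Rightarrow> (nat \<Rightarrow> nat) \<Rightarrow> (nat \<Rightarrow> nat \<Rightarrow> real mat) \<Rightarrow>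
   (nat \<Rightarrow> nat \<Rightarrow> real vec) \<Rightarrow> real vec set" where
  "primal_feasible N E M A b = {x \<in> carrier_vec (dimV N M).
     \<forall>(i, j)\<in>E. A i j *\<^sub>v node_block M x i + A j i *\<^sub>v node_block M x j = b i j}"

definition split_feasible :: "real mat \<Rightarrow> real vec \<Rightarrow> (real vec \<times> real vec) set" where
  "split_feasible C d = {(x, y).
     x \<in> carrier_vec (dim_col C) \<and> y \<in> carrier_vec (dim_row C) \<and> C *\<^sub>v x - d = y}"

definition split_objective ::
  "(real vec \<Rightarrow> ereal) \<Rightarrow> real mat \<Rightarrow> real vec \<times> real vec \<Rightarrow> ereal" where
  "split_objective f P = (\<lambda>(x, y). f x + ind_fun (mat_kernel (1\<^sub>m (dim_row P) + P)) y)"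

definition lagrangian ::
  "(real vec \<Rightarrow> ereal) \<Rightarrow> real mat \<Rightarrow> real vec \<Rightarrow> real mat \<Rightarrow>
   real vec \<Rightarrow> real vec \<Rightarrow> real vec \<Rightarrow> ereal" where
  "lagrangian f C d P x y l = split_objective f P (x, y) - ereal (l \<bullet> (C *\<^sub>v x - d - y))"

definition dual_fun ::
  "(real vec \<Rightarrow> ereal) \<Rightarrow> real mat \<Rightarrow> real vec \<Rightarrow> real mat \<Rightarrow> real vec \<Rightarrow> ereal" where
  "dual_fun f C d P l =
     (INF (x, y)\<in>carrier_vec (dim_col C) \<times> carrier_vec (dim_row C). lagrangian f C d P x y l)"

end

theory Submission
  imports Defs
begin

text \<open>
  Block by block, \<open>P\<close> swaps the two directions of each edge, so it is a symmetric involution,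
  and \<open>y = C x - d\<close> satisfies \<open>y + P y = 0\<close> exactly when \<open>x\<close> satisfies all edge constraints.
  For \<open>l = P l\<close> and \<open>y = - P y\<close> symmetry gives \<open>l \<bullet> y = - (l \<bullet> y) = 0\<close>; for \<open>l \<noteq> P l\<close> the vector
  \<open>y = l - P l\<close> lies in the kernel of \<open>I + P\<close> and has \<open>l \<bullet> y > 0\<close>, so the supremum defining the
  conjugate is infinite along the ray through \<open>y\<close>. The negated dual function is a supremum over
  pairs \<open>(x, y)\<close> that separates, \<open>f\<close> being proper.
\<close>

unbundle no inner_syntax

section \<open>Concatenated blocks\<close>

text \<open>The same fold as in the body of \<open>d_vec\<close>, so that rules for concatenations
  apply to that vector directly.\<close>

definition vconcat :: "real vec list \<Rightarrow> real vec" where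
  "vconcat vs = foldr (@\<^sub>v) vs (0\<^sub>v 0)"

lemma vconcat_simps [simp]:
  "vconcat [] = 0\<^sub>v 0"
  "vconcat (v # vs) = v @\<^sub>v vconcat vs"
  by (simp_all add: vconcat_def)

lemma dim_vconcat: "dim_vec (vconcat vs) = sum_list (map dim_vec vs)"
  by (induction vs) auto

lemma vconcat_append: "vconcat (us @ vs) = vconcat us @\<^sub>v vconcat vs"
  by (induction us) (auto intro!: eq_vecI)

lemma vconcat_concat: "vconcat (concat vss) = vconcat (map vconcat vss)"
  by (induction vss) (simp_all add: vconcat_append)

text \<open>With blocks of length \<open>m j\<close> laid out in increasing order of their indices
  in \<open>S\<close>, this is where block \<open>j\<close> starts. It serves at two levels: for the
  nodes, and for the neighbours of one node.\<close>

definition prefix_sum :: "nat set \<Rightarrow> (nat \<Rightarrow> nat) \<Rightarrow> nat \<Rightarrow> nat" where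
  "prefix_sum S m j = (\<Sum>j'\<in>{j'\<in>S. j' < j}. m j')"

lemma prefix_sum_add_le_prefix_sum:
  assumes "finite S" "j \<in> S" "j < j'"
  shows "prefix_sum S m j + m j \<le> prefix_sum S m j'"
proof -
  have "prefix_sum S m j + m j = sum m (insert j {t\<in>S. t < j})"
    using assms by (simp add: prefix_sum_def)
  also have "\<dots> \<le> prefix_sum S m j'"
    unfolding prefix_sum_def using assms by (intro sum_mono2) auto
  finally show ?thesis .
qed

lemma prefix_sum_add_le_sum:
  assumes "finite S" "j \<in> S"
  shows "prefix_sum S m j + m j \<le> sum m S"
proof -
  have "prefix_sum S m j + m j = sum m (insert j {t\<in>S. t < j})"
    using assms by (simp add: prefix_sum_def)
  also have "\<dots> \<le> sum m S"
    using assms by (intro sum_mono2) auto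
  finally show ?thesis .
qed

text \<open>If the indices differed, the block of the smaller one would end before the other block
  starts, and the two positions could not agree.\<close>

lemma prefix_sum_unique:
  assumes "finite S" "j \<in> S" "j' \<in> S" "k < m j" "k' < m j'"
    and eq: "prefix_sum S m j + k = prefix_sum S m j' + k'"
  shows "j = j' \<and> k = k'"
proof (cases j j' rule: linorder_cases)
  case less
  then show ?thesis using prefix_sum_add_le_prefix_sum[of S j j' m] assms by linarith
next
  case greater
  then show ?thesis using prefix_sum_add_le_prefix_sum[of S j' j m] assms by linarith
qed (use eq in simp)

text \<open>Induction that adds the largest index last: this appends one block at the end and moves
  none of the earlier ones. A position not below the old total lies in the new block.\<close>

lemma prefix_sum_decomp:
  assumes "finite S" "r < sum m S"
  obtains j k where "j \<in> S" "k < m j" "r = prefix_sum S m j + k"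
proof -
  have "\<exists>j k. j \<in> S \<and> k < m j \<and> r = prefix_sum S m j + k"
    using assms
  proof (induction S rule: finite_linorder_max_induct)
    case (insert b S)
    have old: "{t \<in> insert b S. t < j} = {t \<in> S. t < j}" if "j \<in> S" for j
      using insert.hyps(2) that by fastforce
    have new: "{t \<in> insert b S. t < b} = S"
      using insert.hyps(2) by auto
    have b: "b \<notin> S" using insert.hyps(2) by blast
    show ?case
    proof (cases "r < sum m S")
      case True
      then show ?thesis using insert.IH old unfolding prefix_sum_def by (metis insertCI)
    next
      case False
      then have "r - sum m S < m b" "r = prefix_sum (insert b S) m b + (r - sum m S)"
        using insert.prems insert.hyps(1) b new by (auto simp: prefix_sum_def)
      then show ?thesis by blast
    qed
  qed simp
  then show ?thesis using that by blast
qed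

text \<open>The head of a strictly increasing list carries the smallest index, so it starts at 0 and
  shifts every later block by its length. Hence list order agrees with the order used by
  \<open>prefix_sum\<close>.\<close>

lemma index_vconcat_sorted:
  assumes "sorted_wrt (<) js" "j \<in> set js" "k < dim_vec (w j)"
  shows "vconcat (map w js) $ (prefix_sum (set js) (\<lambda>t. dim_vec (w t)) j + k) = w j $ k"
  using assms
proof (induction js)
  case (Cons a js)
  show ?case
  proof (cases "j = a")
    case True
    then have "{t \<in> set (a # js). t < j} = {}" using Cons.prems(1) by auto
    then have "prefix_sum (set (a # js)) (\<lambda>t. dim_vec (w t)) j = 0"
      unfolding prefix_sum_def by (simp only: sum.empty)
    then show ?thesis using True Cons.prems by simp
  next
    case False
    then have j: "j \<in> set js" "a < j" "a \<notin> set js" using Cons.prems by auto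
    then have "{t \<in> set (a # js). t < j} = insert a {t \<in> set js. t < j}" by auto
    then have off: "prefix_sum (set (a # js)) (\<lambda>t. dim_vec (w t)) j
        = dim_vec (w a) + prefix_sum (set js) (\<lambda>t. dim_vec (w t)) j"
      using j by (simp add: prefix_sum_def)
    \<comment> \<open>Indexing into an append requires a bound by the total dimension; this supplies
      it for the tail.\<close>
    have "prefix_sum (set js) (\<lambda>t. dim_vec (w t)) j + k < dim_vec (vconcat (map w js))"
      using prefix_sum_add_le_sum[of "set js" j "\<lambda>t. dim_vec (w t)"] j Cons.prems
      by (simp add: dim_vconcat o_def sum_list_distinct_conv_sum_set strict_sorted_iff)
    then show ?thesis using off Cons j by simp
  qed
qed simp

section \<open>Products of block matrices with vectors\<close>

lemma diag_block_mat_mult_vconcat: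
  assumes "\<And>i. i \<in> set is \<Longrightarrow> w i \<in> carrier_vec (dim_col (B i))"
  shows "diag_block_mat (map B is) *\<^sub>v vconcat (map w is)
    = vconcat (map (\<lambda>i. B i *\<^sub>v w i) is)"
  using assms
proof (induction "is")
  case Nil
  show ?case by (auto intro!: eq_vecI)
next
  case (Cons i "is")
  let ?D = "diag_block_mat (map B is)" and ?v = "vconcat (map w is)"
  have wi: "w i \<in> carrier_vec (dim_col (B i))" using Cons.prems by simp
  have "map dim_vec (map w is) = map dim_col (map B is)"
    using Cons.prems by (auto simp: carrier_vecD)
  then have v: "?v \<in> carrier_vec (dim_col ?D)"
    unfolding carrier_vec_def by (simp add: dim_vconcat dim_diag_block_mat del: map_map)
  \<comment> \<open>The off-diagonal blocks are zero matrices, so the product splits into the first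
    block and the rest.\<close>
  have "diag_block_mat (map B (i # is)) *\<^sub>v (w i @\<^sub>v ?v)
      = (B i *\<^sub>v w i + 0\<^sub>m (dim_row (B i)) (dim_col ?D) *\<^sub>v ?v)
        @\<^sub>v (0\<^sub>m (dim_row ?D) (dim_col (B i)) *\<^sub>v w i + ?D *\<^sub>v ?v)"
    using wi v by (simp add: Let_def, intro four_block_mat_mult_vec) auto
  also have "\<dots> = (B i *\<^sub>v w i) @\<^sub>v (?D *\<^sub>v ?v)"
    using wi v by (intro arg_cong2[of _ _ _ _ "(@\<^sub>v)"]) (auto intro!: eq_vecI simp: scalar_prod_def)
  finally show ?case using Cons by simp
qed

lemma append_rows_list_carrier:
  assumes "\<And>B. B \<in> set Bs \<Longrightarrow> dim_col B = n"
  shows "foldr (@\<^sub>r) Bs (0\<^sub>m 0 n) \<in> carrier_mat (sum_list (map dim_row Bs)) n"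
  using assms
proof (induction Bs)
  case (Cons B Bs)
  have "B \<in> carrier_mat (dim_row B) n" using Cons.prems[of B] by auto
  from carrier_append_rows[OF this Cons.IH] Cons.prems show ?case by auto
qed simp

lemma append_rows_list_mult_vec:
  assumes "\<And>B. B \<in> set Bs \<Longrightarrow> dim_col B = n" and v: "v \<in> carrier_vec n"
  shows "foldr (@\<^sub>r) Bs (0\<^sub>m 0 n) *\<^sub>v v = vconcat (map (\<lambda>B. B *\<^sub>v v) Bs)"
  using assms(1)
proof (induction Bs)
  case Nil
  show ?case by (auto intro!: eq_vecI)
next
  case (Cons B Bs)
  have B: "B \<in> carrier_mat (dim_row B) n" using Cons.prems[of B] by auto
  have D: "foldr (@\<^sub>r) Bs (0\<^sub>m 0 n) \<in> carrier_mat (sum_list (map dim_row Bs)) n"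
    by (rule append_rows_list_carrier) (use Cons.prems in auto)
  show ?case using mat_mult_append[OF B D v] Cons.IH Cons.prems by simp
qed

section \<open>Symmetric involutions\<close>

lemma mem_kernel_one_plus:
  assumes "P \<in> carrier_mat n n"
  shows "y \<in> mat_kernel (1\<^sub>m n + P) \<longleftrightarrow> y \<in> carrier_vec n \<and> y + P *\<^sub>v y = 0\<^sub>v n"
  using assms by (auto simp: mat_kernel_def add_mult_distrib_mat_vec[OF one_carrier_mat assms])

lemma mem_kernel_one_minus:
  assumes "P \<in> carrier_mat n n"
  shows "y \<in> mat_kernel (1\<^sub>m n - P) \<longleftrightarrow> y \<in> carrier_vec n \<and> P *\<^sub>v y = y"
proof -
  have "y - P *\<^sub>v y = 0\<^sub>v n \<longleftrightarrow> P *\<^sub>v y = y" if "y \<in> carrier_vec n"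
    using that assms by (auto simp: vec_eq_iff)
  then show ?thesis
    using assms by (auto simp: mat_kernel_def minus_mult_distrib_mat_vec[OF one_carrier_mat assms])
qed

text \<open>Points outside \<open>K\<close> contribute \<open>-\<infinity>\<close>, so the conjugate
  is the support function of \<open>K\<close>.\<close>

lemma fenchel_conj_ind_fun:
  assumes "K \<subseteq> carrier_vec n"
  shows "fenchel_conj n (ind_fun K) l = (SUP y\<in>K. ereal (l \<bullet> y))"
  unfolding fenchel_conj_def
proof (rule antisym)
  show "(SUP y\<in>carrier_vec n. ereal (l \<bullet> y) - ind_fun K y) \<le> (SUP y\<in>K. ereal (l \<bullet> y))"
    by (rule SUP_least) (auto simp: ind_fun_def intro: SUP_upper)
  show "(SUP y\<in>K. ereal (l \<bullet> y)) \<le> (SUP y\<in>carrier_vec n. ereal (l \<bullet> y) - ind_fun K y)"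
    using assms by (intro SUP_least SUP_upper2) (auto simp: ind_fun_def)
qed

text \<open>For a self-adjoint involution the two kernels are the eigenspaces for -1 and 1, hence
  orthogonal complements of each other; the conjugate of the indicator of a subspace is the
  indicator of its orthogonal complement.\<close>

lemma fenchel_conj_ind_kernel_involution:
  assumes P: "P \<in> carrier_mat n n" and symP: "P\<^sup>T = P"
    and inv: "\<And>v. v \<in> carrier_vec n \<Longrightarrow> P *\<^sub>v (P *\<^sub>v v) = v"
    and l: "l \<in> carrier_vec n"
  shows "fenchel_conj n (ind_fun (mat_kernel (1\<^sub>m n + P))) l = ind_fun (mat_kernel (1\<^sub>m n - P)) l"
proof -
  let ?K = "mat_kernel (1\<^sub>m n + P)"
  note K = mem_kernel_one_plus[OF P] and K' = mem_kernel_one_minus[OF P]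
  have conj: "fenchel_conj n (ind_fun ?K) l = (SUP y\<in>?K. ereal (l \<bullet> y))"
    by (rule fenchel_conj_ind_fun) (use K in auto)
  have selfadj: "(P *\<^sub>v u) \<bullet> v = u \<bullet> (P *\<^sub>v v)" if "u \<in> carrier_vec n" "v \<in> carrier_vec n" for u v
    using transpose_vec_mult_scalar[OF P that(2,1)] symP by simp
  have Pl: "P *\<^sub>v l \<in> carrier_vec n" using P l by simp
  show ?thesis
  proof (cases "P *\<^sub>v l = l")
    case True
    have "l \<bullet> y = 0" if "y \<in> ?K" for y
    proof -
      have y: "y \<in> carrier_vec n" "y + P *\<^sub>v y = 0\<^sub>v n" using that K by auto
      have "l \<bullet> y + l \<bullet> (P *\<^sub>v y) = 0"
        using scalar_prod_add_distrib[OF l y(1), of "P *\<^sub>v y"] y P l by simp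
      moreover have "l \<bullet> (P *\<^sub>v y) = l \<bullet> y" using selfadj[OF l y(1)] True by simp
      ultimately show ?thesis by simp
    qed
    \<comment> \<open>Makes \<open>?K\<close> nonempty; over the empty set the supremum would be
      \<open>-\<infinity>\<close>.\<close>
    moreover have "0\<^sub>v n \<in> ?K" using K P by (simp add: mult_mat_vec_def vec_eq_iff)
    ultimately have "(SUP y\<in>?K. ereal (l \<bullet> y)) = 0"
      by (intro SUP_eq_const[of ?K, THEN trans]) (auto simp: zero_ereal_def)
    then show ?thesis using True l by (simp add: conj ind_fun_def K')
  next
    case False
    \<comment> \<open>Twice the orthogonal projection of \<open>l\<close> onto \<open>?K\<close>; it
      is nonzero precisely because \<open>P\<close> moves \<open>l\<close>.\<close>
    define y where "y = l - P *\<^sub>v l"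
    have y: "y \<in> carrier_vec n" using l Pl by (simp add: y_def)
    have Py: "P *\<^sub>v y = P *\<^sub>v l - l"
      using mult_minus_distrib_mat_vec[OF P l Pl] inv[OF l] by (simp add: y_def)
    have yK: "y + P *\<^sub>v y = 0\<^sub>v n" unfolding Py using l P by (auto simp: vec_eq_iff y_def)
    have tK: "t \<cdot>\<^sub>v y \<in> ?K" for t
    proof -
      have "t \<cdot>\<^sub>v y + P *\<^sub>v (t \<cdot>\<^sub>v y) = t \<cdot>\<^sub>v (y + P *\<^sub>v y)"
        using P y by (simp add: mult_mat_vec smult_add_distrib_vec[of _ n])
      moreover have "t \<cdot>\<^sub>v 0\<^sub>v n = 0\<^sub>v n" by auto
      ultimately show ?thesis using K yK y by simp
    qed
    \<comment> \<open>Self-adjointness together with \<open>P y = - y\<close> turns the second term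
      into another copy of \<open>l \<bullet> y\<close>, which makes \<open>l \<bullet> y\<close>
      half of the squared norm of \<open>y\<close>.\<close>
    have "(l - P *\<^sub>v l) \<bullet> y = l \<bullet> y - (P *\<^sub>v l) \<bullet> y"
      using minus_scalar_prod_distrib[OF l Pl y] .
    also have "(P *\<^sub>v l) \<bullet> y = - (l \<bullet> y)"
      using selfadj[OF l y] scalar_prod_add_distrib[OF l y, of "P *\<^sub>v y"] yK P y l by simp
    finally have "y \<bullet> y = 2 * (l \<bullet> y)" by (simp add: y_def)
    moreover have "y \<noteq> 0\<^sub>v n" using False l Pl by (auto simp: y_def vec_eq_iff)
    then have "y \<bullet> y > 0" using y by (metis conjugate_square_greater_0_vec vec_conjugate_real)
    ultimately have pos: "l \<bullet> y > 0" by simp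
    have "(SUP y\<in>?K. ereal (l \<bullet> y)) = \<infinity>"
    proof (rule SUP_PInfty)
      fix m :: nat
      \<comment> \<open>The multiple of \<open>y\<close> is scaled so that its product with
        \<open>l\<close> is exactly \<open>m\<close>.\<close>
      have "l \<bullet> ((real m / (l \<bullet> y)) \<cdot>\<^sub>v y) = real m" using l y pos by simp
      then show "\<exists>i\<in>?K. ereal (real m) \<le> ereal (l \<bullet> i)" using tK by (metis order_refl)
    qed
    then show ?thesis using False by (simp add: conj ind_fun_def K')
  qed
qed

section \<open>The dual function\<close>

text \<open>The supremum of \<open>r\<close> may be \<open>\<infinity>\<close>, and in
  \<open>ereal\<close> adding \<open>-\<infinity>\<close> to it gives \<open>\<infinity>\<close>,
  whereas every single term would be \<open>-\<infinity>\<close>. The last assumption excludes this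
  case.\<close>

lemma SUP_Times_add:
  fixes a :: "'a \<Rightarrow> ereal" and r :: "'b \<Rightarrow> real"
  assumes "I \<noteq> {}" "J \<noteq> {}" "(SUP i\<in>I. a i) \<noteq> -\<infinity>"
  shows "(SUP (i, j)\<in>I \<times> J. a i + ereal (r j)) = (SUP i\<in>I. a i) + (SUP j\<in>J. ereal (r j))"
proof (rule antisym)
  show "(SUP (i, j)\<in>I \<times> J. a i + ereal (r j)) \<le> (SUP i\<in>I. a i) + (SUP j\<in>J. ereal (r j))"
    by (rule SUP_least) (auto intro!: add_mono SUP_upper)
  have "(SUP i\<in>I. a i) + (SUP j\<in>J. ereal (r j)) = (SUP j\<in>J. SUP i\<in>I. a i + ereal (r j))"
    using assms by (simp add: SUP_ereal_add_left flip: SUP_ereal_add_right)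
  also have "\<dots> \<le> (SUP (i, j)\<in>I \<times> J. a i + ereal (r j))"
    by (intro SUP_least) (rule SUP_upper2[of "(_, _)"], auto)
  finally show "(SUP i\<in>I. a i) + (SUP j\<in>J. ereal (r j)) \<le> (SUP (i, j)\<in>I \<times> J. a i + ereal (r j))" .
qed

lemma uminus_dual_fun:
  assumes C: "C \<in> carrier_mat n m" and d: "d \<in> carrier_vec n" and P: "P \<in> carrier_mat n n"
    and f: "proper_fun m f" and l: "l \<in> carrier_vec n"
  shows "- dual_fun f C d P l = fenchel_conj m f (C\<^sup>T *\<^sub>v l) - ereal (d \<bullet> l)
    + fenchel_conj n (ind_fun (mat_kernel (1\<^sub>m n + P))) l"
proof -
  let ?K = "mat_kernel (1\<^sub>m n + P)"
  let ?X = "carrier_vec m :: real vec set" and ?Y = "carrier_vec n :: real vec set"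
  \<comment> \<open>The part of the negated Lagrangian depending on \<open>x\<close>, with the
    constant \<open>d \<bullet> l\<close> absorbed; what remains depends on \<open>y\<close>
    alone.\<close>
  define a where "a x = ereal ((C\<^sup>T *\<^sub>v l) \<bullet> x) - f x - ereal (d \<bullet> l)" for x
  note K = mem_kernel_one_plus[OF P]
  have K_sub: "?K \<subseteq> ?Y" using K by auto
  have K0: "0\<^sub>v n \<in> ?K" using K P by (simp add: mult_mat_vec_def vec_eq_iff)
  have Kneg: "- y \<in> ?K" if "y \<in> ?K" for y
  proof -
    have y: "y \<in> ?Y" "y + P *\<^sub>v y = 0\<^sub>v n" using that K by auto
    have "- y + P *\<^sub>v (- y) = - (y + P *\<^sub>v y)"
      using P y(1) by (auto simp: vec_eq_iff)
    then show ?thesis using K y by simp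
  qed
  \<comment> \<open>Adding \<open>\<infinity>\<close> gives \<open>\<infinity>\<close> whatever
    \<open>f x\<close> is, so such pairs never raise the supremum.\<close>
  have outside: "- lagrangian f C d P x y l = -\<infinity>" if "y \<notin> ?K" for x y
    using that P by (simp add: lagrangian_def split_objective_def ind_fun_def)
  have inside: "- lagrangian f C d P x y l = a x + ereal (l \<bullet> (- y))"
    if x: "x \<in> ?X" and y: "y \<in> ?K" for x y
  proof -
    have yY: "y \<in> ?Y" using y K_sub by auto
    have Cx: "C *\<^sub>v x \<in> ?Y" using C x by simp
    have "l \<bullet> (C *\<^sub>v x - d - y) = l \<bullet> (C *\<^sub>v x) - l \<bullet> d - l \<bullet> y"
      using scalar_prod_minus_distrib[OF l, of "C *\<^sub>v x - d" y]
        scalar_prod_minus_distrib[OF l Cx d] Cx d yY by simp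
    also have "l \<bullet> (C *\<^sub>v x) = (C\<^sup>T *\<^sub>v l) \<bullet> x"
      using transpose_vec_mult_scalar[OF C x l] by simp
    also have "l \<bullet> d = d \<bullet> l" using d l by (rule comm_scalar_prod[symmetric])
    finally show ?thesis
      using y P yY l f x
      by (cases "f x") (auto simp: lagrangian_def split_objective_def ind_fun_def a_def proper_fun_def)
  qed
  have "- dual_fun f C d P l = (SUP (x, y)\<in>?X \<times> ?Y. - lagrangian f C d P x y l)"
    using C by (simp add: dual_fun_def ereal_SUP_uminus_eq[symmetric] case_prod_unfold)
  also have "\<dots> = (SUP (x, y)\<in>?X \<times> ?K. a x + ereal (l \<bullet> (- y)))"
  proof (rule antisym)
    show "(SUP (x, y)\<in>?X \<times> ?Y. - lagrangian f C d P x y l)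
        \<le> (SUP (x, y)\<in>?X \<times> ?K. a x + ereal (l \<bullet> (- y)))"
    proof (rule SUP_least, clarify)
      fix x y :: "real vec"
      assume x: "x \<in> ?X"
      show "- lagrangian f C d P x y l \<le> (SUP (x, y)\<in>?X \<times> ?K. a x + ereal (l \<bullet> (- y)))"
      proof (cases "y \<in> ?K")
        case True
        then show ?thesis using x inside[OF x True] by (intro SUP_upper2[of "(x, y)"]) auto
      qed (simp add: outside)
    qed
    show "(SUP (x, y)\<in>?X \<times> ?K. a x + ereal (l \<bullet> (- y)))
        \<le> (SUP (x, y)\<in>?X \<times> ?Y. - lagrangian f C d P x y l)"
    proof (rule SUP_least, clarify)
      fix x y :: "real vec"
      assume "x \<in> ?X" "y \<in> ?K"
      then show "a x + ereal (l \<bullet> (- y)) \<le> (SUP (x, y)\<in>?X \<times> ?Y. - lagrangian f C d P x y l)"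
        using K_sub inside by (intro SUP_upper2[of "(x, y)"]) auto
    qed
  qed
  also have "\<dots> = (SUP x\<in>?X. a x) + (SUP y\<in>?K. ereal (l \<bullet> (- y)))"
  proof (rule SUP_Times_add)
    \<comment> \<open>Properness yields a point at which \<open>a\<close> is not
      \<open>-\<infinity>\<close>, as separating the supremum requires.\<close>
    obtain x where x: "x \<in> ?X" "f x \<noteq> \<infinity>" using f by (auto simp: proper_fun_def)
    then have "a x \<noteq> -\<infinity>" unfolding a_def by (cases "f x") auto
    moreover have "a x \<le> (SUP x\<in>?X. a x)" using x(1) by (rule SUP_upper)
    ultimately show "(SUP x\<in>?X. a x) \<noteq> -\<infinity>" by auto
    show "?X \<noteq> {}" using x by auto
    show "?K \<noteq> {}" using K0 by blast
  qed
  also have "(SUP x\<in>?X. a x) = fenchel_conj m f (C\<^sup>T *\<^sub>v l) - ereal (d \<bullet> l)"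
    unfolding a_def fenchel_conj_def by (rule SUP_ereal_minus_left) (auto intro: zero_carrier_vec)
  \<comment> \<open>The Lagrangian produces \<open>- y\<close>; the sign disappears because the
    kernel is closed under negation.\<close>
  also have "(SUP y\<in>?K. ereal (l \<bullet> (- y))) = (SUP y\<in>?K. ereal (l \<bullet> y))"
  proof -
    have "uminus ` ?K = ?K"
      using Kneg by (auto simp: image_iff) (metis uminus_uminus_vec)
    then have "(SUP y\<in>?K. ereal (l \<bullet> y)) = (SUP y\<in>uminus ` ?K. ereal (l \<bullet> y))" by simp
    then show ?thesis by (simp add: image_image)
  qed
  also have "(SUP y\<in>?K. ereal (l \<bullet> y)) = fenchel_conj n (ind_fun ?K) l"
    by (rule fenchel_conj_ind_fun[symmetric]) (rule K_sub)
  finally show ?thesis .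
qed

section \<open>The network\<close>

text \<open>Both \<open>C x\<close> and \<open>d\<close> are instances, so their difference can be
  read off block by block.\<close>

definition edge_concat :: "nat \<Rightarrow> (nat \<times> nat) set \<Rightarrow> (nat \<Rightarrow> nat \<Rightarrow> real vec) \<Rightarrow> real vec" where
  "edge_concat N E w =
     vconcat (concat (map (\<lambda>i. map (w i) (sorted_list_of_set (nbrs E i))) [1..<Suc N]))"

lemma d_vec_eq_edge_concat: "d_vec N E b = edge_concat N E (\<lambda>i j. (1/2) \<cdot>\<^sub>v b i j)"
  by (simp add: d_vec_def edge_concat_def vconcat_def)

section \<open>Node vectors and their blocks\<close>

lemma set_upt_Suc: "set [1..<Suc N] = {1..N}"
  by auto

text \<open>Connects \<open>prefix_sum\<close> with the sums over \<open>{1..<i}\<close> that occur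
  in \<open>node_block\<close> and \<open>edge_offset\<close>.\<close>

lemma prefix_sum_interval:
  assumes "i \<in> {1..N}"
  shows "prefix_sum {1..N} m i = (\<Sum>i'\<in>{1..<i}. m i')"
proof -
  have "{t \<in> {1..N}. t < i} = {1..<i}" using assms by auto
  then show ?thesis by (simp only: prefix_sum_def)
qed

lemma node_block_vconcat:
  assumes "\<And>i. i \<in> {1..N} \<Longrightarrow> w i \<in> carrier_vec (M i)" and i: "i \<in> {1..N}"
  shows "node_block M (vconcat (map w [1..<Suc N])) i = w i"
proof (rule eq_vecI)
  fix k assume "k < dim_vec (w i)"
  then have k: "k < M i" "k < dim_vec (w i)" using carrier_vecD[OF assms(1)[OF i]] by auto
  have "prefix_sum {1..N} (\<lambda>t. dim_vec (w t)) i = (\<Sum>i'\<in>{1..<i}. M i')"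
    unfolding prefix_sum_interval[OF i] using assms by (intro sum.cong) auto
  then show "node_block M (vconcat (map w [1..<Suc N])) i $ k = w i $ k"
    using index_vconcat_sorted[of "[1..<Suc N]" i k w] k i
    unfolding set_upt_Suc by (simp add: node_block_def sorted_wrt_upt del: upt_Suc)
qed (use carrier_vecD[OF assms(1)[OF i]] in \<open>simp add: node_block_def\<close>)

lemma vconcat_interval_carrier:
  assumes "\<And>i. i \<in> {1..N} \<Longrightarrow> w i \<in> carrier_vec (M i)"
  shows "vconcat (map w [1..<Suc N]) \<in> carrier_vec (dimV N M)"
proof -
  have "sum_list (map (\<lambda>i. dim_vec (w i)) [1..<Suc N]) = (\<Sum>i\<in>{1..N}. dim_vec (w i))"
    by (simp only: sum_list_distinct_conv_sum_set distinct_upt set_upt_Suc)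
  also have "\<dots> = dimV N M"
    unfolding dimV_def using assms by (intro sum.cong) auto
  finally show ?thesis
    unfolding carrier_vec_def mem_Collect_eq dim_vconcat map_map o_def .
qed

text \<open>By \<open>node_block_vconcat\<close> both sides have the same node blocks, and every
  position lies in one of these.\<close>

lemma vconcat_node_block:
  assumes x: "x \<in> carrier_vec (dimV N M)"
  shows "vconcat (map (node_block M x) [1..<Suc N]) = x"
proof (rule eq_vecI)
  have car: "node_block M x i \<in> carrier_vec (M i)" for i
    by (simp add: node_block_def)
  then have carV: "vconcat (map (node_block M x) [1..<Suc N]) \<in> carrier_vec (dimV N M)"
    by (intro vconcat_interval_carrier)
  then show "dim_vec (vconcat (map (node_block M x) [1..<Suc N])) = dim_vec x"
    using x by auto
  fix r assume "r < dim_vec x"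
  then have "r < sum M {1..N}" using x by (simp add: dimV_def)
  then obtain i k where i: "i \<in> {1..N}" and k: "k < M i" and r: "r = prefix_sum {1..N} M i + k"
    using prefix_sum_decomp[of "{1..N}" r M] by blast
  have "node_block M (vconcat (map (node_block M x) [1..<Suc N])) i = node_block M x i"
    using car i by (intro node_block_vconcat)
  then have "node_block M (vconcat (map (node_block M x) [1..<Suc N])) i $ k = node_block M x i $ k"
    by simp
  then show "vconcat (map (node_block M x) [1..<Suc N]) $ r = x $ r"
    unfolding r prefix_sum_interval[OF i] using k by (simp add: node_block_def del: upt_Suc)
qed

section \<open>Properness of the separable sum\<close>

lemma sum_not_MInfty:
  fixes g :: "'a \<Rightarrow> ereal"
  assumes "\<And>i. i \<in> S \<Longrightarrow> g i \<noteq> -\<infinity>"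
  shows "sum g S \<noteq> -\<infinity>"
  using assms by (induction S rule: infinite_finite_induct) auto

text \<open>The node variables are independent: points of finite value, chosen separately for each
  node, concatenate to a point where the sum is not \<open>\<infinity>\<close>.\<close>

lemma proper_fun_sep_sum:
  assumes "\<And>i. i \<in> {1..N} \<Longrightarrow> proper_fun (M i) (fs i)"
  shows "proper_fun (dimV N M) (sep_sum N M fs)"
  unfolding proper_fun_def
proof
  have "fs i (node_block M x i) \<noteq> -\<infinity>" if "i \<in> {1..N}" for i x
    using assms[OF that] by (simp add: proper_fun_def node_block_def)
  then show "\<forall>x\<in>carrier_vec (dimV N M). sep_sum N M fs x \<noteq> -\<infinity>"
    unfolding sep_sum_def by (intro ballI sum_not_MInfty) auto
  have "\<forall>i\<in>{1..N}. \<exists>v. v \<in> carrier_vec (M i) \<and> fs i v \<noteq> \<infinity>"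
    using assms unfolding proper_fun_def by blast
  then obtain w where w: "\<And>i. i \<in> {1..N} \<Longrightarrow> w i \<in> carrier_vec (M i) \<and> fs i (w i) \<noteq> \<infinity>"
    by metis
  have "sep_sum N M fs (vconcat (map w [1..<Suc N])) = (\<Sum>i\<in>{1..N}. fs i (w i))"
    unfolding sep_sum_def using node_block_vconcat[of N w M] w by (intro sum.cong refl) metis
  also have "\<dots> \<noteq> \<infinity>" using w by (auto simp: sum_Pinfty)
  finally show "\<exists>x\<in>carrier_vec (dimV N M). sep_sum N M fs x \<noteq> \<infinity>"
    using vconcat_interval_carrier[of N w M] w by blast
qed

text \<open>The two symmetry conditions make blocks \<open>i|j\<close> and \<open>j|i\<close> exist
  together and have equal length, so that they can be exchanged.\<close>

locale network =
  fixes N :: nat and E :: "(nat \<times> nat) set" and ME :: "nat \<Rightarrow> nat \<Rightarrow> nat"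
  assumes E_nodes: "E \<subseteq> {1..N} \<times> {1..N}"
    and E_sym: "(i, j) \<in> E \<Longrightarrow> (j, i) \<in> E"
    and ME_sym: "(i, j) \<in> E \<Longrightarrow> ME i j = ME j i"
begin

section \<open>Positions in edge vectors\<close>

lemma finite_nbrs: "finite (nbrs E i)"
  by (rule finite_subset[of _ "{1..N}"]) (use E_nodes in \<open>auto simp: nbrs_def\<close>)

lemma set_nbrs_list: "set (sorted_list_of_set (nbrs E i)) = nbrs E i"
  using finite_nbrs by simp

lemma edge_node: "(i, j) \<in> E \<Longrightarrow> i \<in> {1..N}"
  using E_nodes by auto

text \<open>The layout has two levels: the segment of node \<open>i\<close>, then the block of
  neighbour \<open>j\<close> inside it. Existence and uniqueness of coordinates thus follow from the
  one-level results, applied twice.\<close>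

lemma edge_offset_eq_prefix_sum:
  assumes "(i, j) \<in> E"
  shows "edge_offset E ME i j
    = prefix_sum {1..N} (\<lambda>i. sum (ME i) (nbrs E i)) i + prefix_sum (nbrs E i) (ME i) j"
  by (simp only: edge_offset_def prefix_sum_interval[OF edge_node[OF assms]] prefix_sum_def[of "nbrs E i"])

lemma node_offset_less:
  assumes "(i, j) \<in> E" "k < ME i j"
  shows "prefix_sum (nbrs E i) (ME i) j + k < sum (ME i) (nbrs E i)"
  using prefix_sum_add_le_sum[OF finite_nbrs, of j i "ME i"] assms by (simp add: nbrs_def)

lemma edge_offset_less:
  assumes "(i, j) \<in> E" "k < ME i j"
  shows "edge_offset E ME i j + k < dimE N E ME"
  using node_offset_less[OF assms] edge_offset_eq_prefix_sum[OF assms(1)] edge_node[OF assms(1)]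
    prefix_sum_add_le_sum[of "{1..N}" i "\<lambda>i. sum (ME i) (nbrs E i)"]
  by (simp add: dimE_def)

lemma edge_index_cases:
  assumes "r < dimE N E ME"
  obtains i j k where "(i, j) \<in> E" "k < ME i j" "r = edge_offset E ME i j + k"
proof -
  obtain i k' where i: "i \<in> {1..N}" and k': "k' < sum (ME i) (nbrs E i)"
    and r: "r = prefix_sum {1..N} (\<lambda>i. sum (ME i) (nbrs E i)) i + k'"
    using prefix_sum_decomp[of "{1..N}" r "\<lambda>i. sum (ME i) (nbrs E i)"] assms
    by (auto simp: dimE_def)
  obtain j k where j: "j \<in> nbrs E i" "k < ME i j" "k' = prefix_sum (nbrs E i) (ME i) j + k"
    using prefix_sum_decomp[OF finite_nbrs k'] by blast
  have "(i, j) \<in> E" using j by (simp add: nbrs_def)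
  then show ?thesis using that j r edge_offset_eq_prefix_sum by simp
qed

lemma edge_offset_unique:
  assumes e: "(i, j) \<in> E" "k < ME i j" and e': "(i', j') \<in> E" "k' < ME i' j'"
    and eq: "edge_offset E ME i j + k = edge_offset E ME i' j' + k'"
  shows "i = i' \<and> j = j' \<and> k = k'"
proof -
  \<comment> \<open>At the node level the position inside the segment plays the role of the
    remainder; the neighbour level then splits it further.\<close>
  have "i = i' \<and> prefix_sum (nbrs E i) (ME i) j + k = prefix_sum (nbrs E i') (ME i') j' + k'"
    by (rule prefix_sum_unique[of "{1..N}" _ _ _ "\<lambda>i. sum (ME i) (nbrs E i)"])
      (use node_offset_less[OF e] node_offset_less[OF e'] edge_node[OF e(1)] edge_node[OF e'(1)]
        edge_offset_eq_prefix_sum[OF e(1)] edge_offset_eq_prefix_sum[OF e'(1)] eq in auto)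
  then show ?thesis
    using prefix_sum_unique[OF finite_nbrs, of j i j' k "ME i" k'] e e' by (auto simp: nbrs_def)
qed

lemma edge_vec_eqI:
  assumes "u \<in> carrier_vec (dimE N E ME)" "v \<in> carrier_vec (dimE N E ME)"
    and "\<And>i j k. (i, j) \<in> E \<Longrightarrow> k < ME i j \<Longrightarrow>
      u $ (edge_offset E ME i j + k) = v $ (edge_offset E ME i j + k)"
  shows "u = v"
proof (rule eq_vecI)
  fix r assume "r < dim_vec v"
  then have "r < dimE N E ME" using assms(2) by simp
  then show "u $ r = v $ r" using assms(3) by (auto elim: edge_index_cases)
qed (use assms in auto)

section \<open>The permutation exchanging the two directions of each edge\<close>

lemma P_mat_carrier: "P_mat N E ME \<in> carrier_mat (dimE N E ME) (dimE N E ME)"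
  by (simp add: P_mat_def)

text \<open>Renaming \<open>(i, j)\<close> to \<open>(j, i)\<close> interchanges the row and column
  conditions, since \<open>E\<close> and \<open>ME\<close> are symmetric.\<close>

lemma P_mat_transpose: "(P_mat N E ME)\<^sup>T = P_mat N E ME"
proof -
  have "(\<exists>i j k. (i, j) \<in> E \<and> k < ME i j \<and>
        r = edge_offset E ME i j + k \<and> c = edge_offset E ME j i + k)
      \<longleftrightarrow> (\<exists>i j k. (i, j) \<in> E \<and> k < ME i j \<and>
        c = edge_offset E ME i j + k \<and> r = edge_offset E ME j i + k)" for r c
    using E_sym ME_sym by fastforce
  then show ?thesis by (intro eq_matI) (simp_all add: P_mat_def)
qed

text \<open>A position determines its edge and remainder uniquely, so row \<open>?r\<close> holds a
  single 1, in column \<open>?c\<close>.\<close>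

lemma index_P_mat_mult:
  assumes e: "(i, j) \<in> E" "k < ME i j" and y: "y \<in> carrier_vec (dimE N E ME)"
  shows "(P_mat N E ME *\<^sub>v y) $ (edge_offset E ME i j + k) = y $ (edge_offset E ME j i + k)"
proof -
  let ?r = "edge_offset E ME i j + k" and ?c = "edge_offset E ME j i + k"
  have r: "?r < dimE N E ME" using edge_offset_less[OF e] .
  have c: "?c < dimE N E ME" using edge_offset_less[of j i k] e E_sym ME_sym by simp
  have entry: "P_mat N E ME $$ (?r, c') = (if c' = ?c then 1 else 0)" if "c' < dimE N E ME" for c'
  proof -
    have "(\<exists>i' j' k'. (i', j') \<in> E \<and> k' < ME i' j' \<and> ?r = edge_offset E ME i' j' + k'
        \<and> c' = edge_offset E ME j' i' + k') \<longleftrightarrow> c' = ?c"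
      using edge_offset_unique[OF e] e by blast
    then show ?thesis using r that by (simp add: P_mat_def)
  qed
  have "(P_mat N E ME *\<^sub>v y) $ ?r = (\<Sum>c'\<in>{0..<dimE N E ME}. P_mat N E ME $$ (?r, c') * y $ c')"
    using r y P_mat_carrier by (simp add: scalar_prod_def)
  also have "\<dots> = (\<Sum>c'\<in>{0..<dimE N E ME}. if c' = ?c then y $ c' else 0)"
    by (intro sum.cong refl) (simp add: entry)
  also have "\<dots> = y $ ?c" using c by simp
  finally show ?thesis .
qed

lemma P_mat_involution:
  assumes y: "y \<in> carrier_vec (dimE N E ME)"
  shows "P_mat N E ME *\<^sub>v (P_mat N E ME *\<^sub>v y) = y"
proof (rule edge_vec_eqI)
  have Py: "P_mat N E ME *\<^sub>v y \<in> carrier_vec (dimE N E ME)"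
    using P_mat_carrier y by simp
  then show "P_mat N E ME *\<^sub>v (P_mat N E ME *\<^sub>v y) \<in> carrier_vec (dimE N E ME)"
    using P_mat_carrier by simp
  fix i j k assume e: "(i, j) \<in> E" "k < ME i j"
  then have e': "(j, i) \<in> E" "k < ME j i" using E_sym ME_sym by auto
  show "(P_mat N E ME *\<^sub>v (P_mat N E ME *\<^sub>v y)) $ (edge_offset E ME i j + k)
      = y $ (edge_offset E ME i j + k)"
    using index_P_mat_mult[OF e Py] index_P_mat_mult[OF e' y] by simp
qed (fact y)

lemma mem_kernel_one_plus_P_mat:
  assumes y: "y \<in> carrier_vec (dimE N E ME)"
  shows "y \<in> mat_kernel (1\<^sub>m (dimE N E ME) + P_mat N E ME) \<longleftrightarrow>
    (\<forall>i j k. (i, j) \<in> E \<longrightarrow> k < ME i j \<longrightarrow>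
      y $ (edge_offset E ME i j + k) + y $ (edge_offset E ME j i + k) = 0)"
proof -
  let ?P = "P_mat N E ME" and ?n = "dimE N E ME"
  have Py: "?P *\<^sub>v y \<in> carrier_vec ?n" using P_mat_carrier y by simp
  have idx: "(y + ?P *\<^sub>v y) $ (edge_offset E ME i j + k)
      = y $ (edge_offset E ME i j + k) + y $ (edge_offset E ME j i + k)"
    if "(i, j) \<in> E" "k < ME i j" for i j k
    using index_add_vec(1)[of "edge_offset E ME i j + k" "?P *\<^sub>v y" y] carrier_vecD[OF Py]
      edge_offset_less[OF that] index_P_mat_mult[OF that y] by simp
  have "y + ?P *\<^sub>v y = 0\<^sub>v ?n \<longleftrightarrow> (\<forall>i j k. (i, j) \<in> E \<longrightarrow> k < ME i j \<longrightarrow>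
      y $ (edge_offset E ME i j + k) + y $ (edge_offset E ME j i + k) = 0)" (is "_ \<longleftrightarrow> ?R")
  proof
    assume "y + ?P *\<^sub>v y = 0\<^sub>v ?n"
    then show ?R using idx edge_offset_less by (metis index_zero_vec(1))
  next
    assume ?R
    then show "y + ?P *\<^sub>v y = 0\<^sub>v ?n"
      using idx edge_offset_less y Py by (intro edge_vec_eqI) auto
  qed
  then show ?thesis using y by (simp add: mem_kernel_one_plus[OF P_mat_carrier])
qed

section \<open>Edge vectors given by their blocks\<close>

lemma dim_nbrs_vconcat:
  assumes "\<And>i j. (i, j) \<in> E \<Longrightarrow> w i j \<in> carrier_vec (ME i j)"
  shows "dim_vec (vconcat (map (w i) (sorted_list_of_set (nbrs E i)))) = sum (ME i) (nbrs E i)"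
proof -
  have "dim_vec (vconcat (map (w i) (sorted_list_of_set (nbrs E i))))
      = (\<Sum>j\<in>nbrs E i. dim_vec (w i j))"
    by (simp add: dim_vconcat o_def sum_list_distinct_conv_sum_set finite_nbrs)
  also have "\<dots> = sum (ME i) (nbrs E i)"
    using assms by (intro sum.cong) (auto simp: nbrs_def)
  finally show ?thesis .
qed

lemma edge_concat_carrier:
  assumes "\<And>i j. (i, j) \<in> E \<Longrightarrow> w i j \<in> carrier_vec (ME i j)"
  shows "edge_concat N E w \<in> carrier_vec (dimE N E ME)"
proof -
  have "vconcat (map (w i) (sorted_list_of_set (nbrs E i))) \<in> carrier_vec (sum (ME i) (nbrs E i))"
    for i
    using dim_nbrs_vconcat[OF assms] by (rule carrier_vecI)
  then have "edge_concat N E w \<in> carrier_vec (dimV N (\<lambda>i. sum (ME i) (nbrs E i)))"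
    unfolding edge_concat_def vconcat_concat map_map o_def by (rule vconcat_interval_carrier)
  then show ?thesis by (simp only: dimV_def dimE_def)
qed

text \<open>Two uses of \<open>index_vconcat_sorted\<close>: on the list of nodes, then on the
  sorted neighbours of \<open>i\<close>.\<close>

lemma index_edge_concat:
  assumes w: "\<And>i j. (i, j) \<in> E \<Longrightarrow> w i j \<in> carrier_vec (ME i j)"
    and e: "(i, j) \<in> E" "k < ME i j"
  shows "edge_concat N E w $ (edge_offset E ME i j + k) = w i j $ k"
proof -
  let ?b = "\<lambda>i. vconcat (map (w i) (sorted_list_of_set (nbrs E i)))"
  let ?k = "prefix_sum (nbrs E i) (ME i) j + k"
  have dim: "dim_vec (?b i) = sum (ME i) (nbrs E i)" for i
    using dim_nbrs_vconcat[OF w] .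
  have "edge_concat N E w $ (edge_offset E ME i j + k)
      = vconcat (map ?b [1..<Suc N]) $ (prefix_sum (set [1..<Suc N]) (\<lambda>t. dim_vec (?b t)) i + ?k)"
    unfolding edge_concat_def vconcat_concat map_map o_def edge_offset_eq_prefix_sum[OF e(1)]
      dim set_upt_Suc by (simp only: add.assoc)
  also have "\<dots> = ?b i $ ?k"
    using node_offset_less[OF e] edge_node[OF e(1)] dim
    by (intro index_vconcat_sorted) (simp_all only: set_upt_Suc sorted_wrt_upt)
  \<comment> \<open>Prescribed block lengths are replaced by actual dimensions, the form in which
    \<open>index_vconcat_sorted\<close> measures offsets.\<close>
  also have "prefix_sum (nbrs E i) (ME i) j
      = prefix_sum (set (sorted_list_of_set (nbrs E i))) (\<lambda>t. dim_vec (w i t)) j"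
    unfolding prefix_sum_def set_nbrs_list using carrier_vecD[OF w]
    by (intro sum.cong refl) (simp add: nbrs_def)
  also have "?b i $ (\<dots> + k) = w i j $ k"
    by (rule index_vconcat_sorted) (use e carrier_vecD[OF w[OF e(1)]] in
      \<open>simp_all add: set_nbrs_list, simp add: nbrs_def\<close>)
  finally show ?thesis .
qed

section \<open>The constraint matrix and the edge constraints\<close>

context
  fixes M :: "nat \<Rightarrow> nat" and A :: "nat \<Rightarrow> nat \<Rightarrow> real mat"
  assumes A: "\<And>i j. (i, j) \<in> E \<Longrightarrow> A i j \<in> carrier_mat (ME i j) (M i)"
begin

lemma C_node_carrier: "C_node E M A i \<in> carrier_mat (sum (ME i) (nbrs E i)) (M i)"
proof -
  have A': "dim_col (A i j) = M i" "dim_row (A i j) = ME i j" if "j \<in> nbrs E i" for j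
    using A[of i j] that by (auto simp: nbrs_def)
  have "sum_list (map dim_row (map (A i) (sorted_list_of_set (nbrs E i)))) = sum (ME i) (nbrs E i)"
    using A' by (simp add: o_def sum_list_distinct_conv_sum_set finite_nbrs)
  then show ?thesis
    using append_rows_list_carrier[of "map (A i) (sorted_list_of_set (nbrs E i))" "M i"] A'
    by (auto simp: C_node_def set_nbrs_list)
qed

lemma C_node_mult:
  assumes "v \<in> carrier_vec (M i)"
  shows "C_node E M A i *\<^sub>v v = vconcat (map (\<lambda>j. A i j *\<^sub>v v) (sorted_list_of_set (nbrs E i)))"
proof -
  have "dim_col (A i j) = M i" if "j \<in> nbrs E i" for j
    using A[of i j] that by (auto simp: nbrs_def)
  then show ?thesis
    unfolding C_node_def using assms
    by (subst append_rows_list_mult_vec) (auto simp: set_nbrs_list o_def)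
qed

lemma C_mat_carrier: "C_mat N E M A \<in> carrier_mat (dimE N E ME) (dimV N M)"
proof -
  have "map dim_row (map (C_node E M A) [1..<Suc N]) = map (\<lambda>i. sum (ME i) (nbrs E i)) [1..<Suc N]"
    "map dim_col (map (C_node E M A) [1..<Suc N]) = map M [1..<Suc N]"
    using C_node_carrier by (auto simp: o_def)
  then show ?thesis
    unfolding C_mat_def carrier_mat_def mem_Collect_eq dim_diag_block_mat dimE_def dimV_def
    by (simp only: sum_list_distinct_conv_sum_set distinct_upt set_upt_Suc simp_thms)
qed

text \<open>Once \<open>x\<close> is written as the concatenation of its node blocks, the diagonal
  blocks act separately, and each stacked \<open>C_node\<close> yields one block per
  neighbour.\<close>

lemma C_mat_mult:
  assumes x: "x \<in> carrier_vec (dimV N M)"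
  shows "C_mat N E M A *\<^sub>v x = edge_concat N E (\<lambda>i j. A i j *\<^sub>v node_block M x i)"
proof -
  have nb: "node_block M x i \<in> carrier_vec (M i)" for i by (simp add: node_block_def)
  have "C_mat N E M A *\<^sub>v x
      = diag_block_mat (map (C_node E M A) [1..<Suc N]) *\<^sub>v vconcat (map (node_block M x) [1..<Suc N])"
    unfolding C_mat_def vconcat_node_block[OF x] ..
  also have "\<dots> = vconcat (map (\<lambda>i. C_node E M A i *\<^sub>v node_block M x i) [1..<Suc N])"
    by (rule diag_block_mat_mult_vconcat) (use nb C_node_carrier in \<open>metis carrier_matD(2)\<close>)
  also have "\<dots> = edge_concat N E (\<lambda>i j. A i j *\<^sub>v node_block M x i)"
    unfolding edge_concat_def vconcat_concat map_map o_def C_node_mult[OF nb] ..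
  finally show ?thesis .
qed

text \<open>Adding blocks \<open>i|j\<close> and \<open>j|i\<close> of the residual joins the halves
  of \<open>b i j\<close> and \<open>b j i\<close>, equal by symmetry, into all of
  \<open>b i j\<close>; the sum vanishes exactly when the edge constraint holds.\<close>

lemma residual_mem_kernel_iff_primal_feasible:
  assumes b: "\<And>i j. (i, j) \<in> E \<Longrightarrow> b i j \<in> carrier_vec (ME i j)"
    and b_sym: "\<And>i j. (i, j) \<in> E \<Longrightarrow> b i j = b j i"
    and x: "x \<in> carrier_vec (dimV N M)"
  shows "C_mat N E M A *\<^sub>v x - d_vec N E b \<in> mat_kernel (1\<^sub>m (dimE N E ME) + P_mat N E ME)
    \<longleftrightarrow> x \<in> primal_feasible N E M A b"
proof -
  let ?y = "C_mat N E M A *\<^sub>v x - d_vec N E b"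
  let ?u = "\<lambda>i j. A i j *\<^sub>v node_block M x i" and ?v = "\<lambda>i j. (1/2) \<cdot>\<^sub>v b i j"
  have u: "?u i j \<in> carrier_vec (ME i j)" if "(i, j) \<in> E" for i j
    using A[OF that] by (simp add: node_block_def)
  have v: "?v i j \<in> carrier_vec (ME i j)" if "(i, j) \<in> E" for i j
    using b[OF that] by simp
  have y: "?y \<in> carrier_vec (dimE N E ME)"
    using edge_concat_carrier[of ?u] edge_concat_carrier[of ?v] u v
    by (simp add: C_mat_mult[OF x] d_vec_eq_edge_concat)
  have yidx: "?y $ (edge_offset E ME i j + k) = ?u i j $ k - b i j $ k / 2"
    if e: "(i, j) \<in> E" "k < ME i j" for i j k
    using index_edge_concat[of ?u, OF u e] index_edge_concat[of ?v, OF v e] b[OF e(1)] e(2)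
      edge_offset_less[OF e] edge_concat_carrier[of ?v] v
    by (simp add: C_mat_mult[OF x] d_vec_eq_edge_concat)
  have edge: "(\<forall>k<ME i j. ?y $ (edge_offset E ME i j + k) + ?y $ (edge_offset E ME j i + k) = 0)
      \<longleftrightarrow> ?u i j + ?u j i = b i j" if e: "(i, j) \<in> E" for i j
  proof -
    have e': "(j, i) \<in> E" "ME j i = ME i j" using e E_sym ME_sym by auto
    have dims: "dim_vec (?u j i) = ME i j" "dim_vec (b i j) = ME i j"
      using carrier_vecD[OF u[OF e'(1)]] carrier_vecD[OF b[OF e]] e' by simp_all
    have "?y $ (edge_offset E ME i j + k) + ?y $ (edge_offset E ME j i + k) = 0
        \<longleftrightarrow> (?u i j + ?u j i) $ k = b i j $ k" if k: "k < ME i j" for k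
      using yidx[OF e k] yidx[OF e'(1)] k e' b_sym[OF e] dims
        index_add_vec(1)[of k "?u j i" "?u i j"] by auto
    then show ?thesis using dims by (auto simp: vec_eq_iff[of "_ + _"])
  qed
  show ?thesis
    unfolding mem_kernel_one_plus_P_mat[OF y] primal_feasible_def using x edge by auto
qed

end

end

section \<open>Minimisation over the graph of a map\<close>

text \<open>Points outside \<open>F\<close> have value \<open>\<infinity>\<close> and leave the
  infimum unchanged.\<close>

lemma optimal_value_graph:
  assumes "F \<subseteq> X" and "\<And>x. x \<in> X \<Longrightarrow> G (x, h x) = (if x \<in> F then f x else \<infinity>)"
  shows "optimal_value ((\<lambda>x. (x, h x)) ` X) G = optimal_value F f"
  unfolding optimal_value_def image_image
proof (rule antisym)
  show "(INF x\<in>X. G (x, h x)) \<le> (INF x\<in>F. f x)"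
    using assms by (intro INF_mono) force
  show "(INF x\<in>F. f x) \<le> (INF x\<in>X. G (x, h x))"
    using assms by (intro INF_greatest) (auto intro: INF_lower)
qed

text \<open>Since \<open>minimisers\<close> rejects the value \<open>\<infinity>\<close>, points
  outside \<open>F\<close> drop out even if \<open>f\<close> is \<open>\<infinity>\<close> on all of
  \<open>F\<close>.\<close>

lemma minimisers_graph:
  assumes "F \<subseteq> X" and "\<And>x. x \<in> X \<Longrightarrow> G (x, h x) = (if x \<in> F then f x else \<infinity>)"
  shows "minimisers ((\<lambda>x. (x, h x)) ` X) G = (\<lambda>x. (x, h x)) ` minimisers F f"
proof -
  have "x \<in> X \<and> G (x, h x) \<noteq> \<infinity> \<and> (\<forall>z\<in>X. G (x, h x) \<le> G (z, h z))
      \<longleftrightarrow> x \<in> F \<and> f x \<noteq> \<infinity> \<and> (\<forall>z\<in>F. f x \<le> f z)" for x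
    using assms by (auto split: if_splits)
  then show ?thesis unfolding minimisers_def by auto
qed

section \<open>Equivalence of the split problem and identity of the two duals\<close>

theorem mainTheorem5:
  fixes N :: nat and E :: "(nat \<times> nat) set"
    and M :: "nat \<Rightarrow> nat" and ME :: "nat \<Rightarrow> nat \<Rightarrow> nat"
    and fs :: "nat \<Rightarrow> real vec \<Rightarrow> ereal"
    and A :: "nat \<Rightarrow> nat \<Rightarrow> real mat" and b :: "nat \<Rightarrow> nat \<Rightarrow> real vec"
    and f :: "real vec \<Rightarrow> ereal" and C P :: "real mat" and d :: "real vec"
    and mV mE :: nat
  assumes "E \<subseteq> {1..N} \<times> {1..N}" and "sym E"
    and "\<And>i j. (i, j) \<in> E \<Longrightarrow> ME i j = ME j i"
    and "\<And>i. i \<in> {1..N} \<Longrightarrow> fs i \<in> Gamma0 (M i)"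
    and "\<And>i j. (i, j) \<in> E \<Longrightarrow> A i j \<in> carrier_mat (ME i j) (M i)"
    and "\<And>i j. (i, j) \<in> E \<Longrightarrow> b i j \<in> carrier_vec (ME i j)"
    and "\<And>i j. (i, j) \<in> E \<Longrightarrow> b i j = b j i"
    and "mV = dimV N M" and "mE = dimE N E ME"
    and "f = sep_sum N M fs"
    and "C = C_mat N E M A" and "d = d_vec N E b" and "P = P_mat N E ME"
  shows "(optimal_value (split_feasible C d) (split_objective f P)
            = optimal_value (primal_feasible N E M A b) f
          \<and> minimisers (split_feasible C d) (split_objective f P)
            = (\<lambda>x. (x, C *\<^sub>v x - d)) ` minimisers (primal_feasible N E M A b) f)
       \<and> (\<forall>l\<in>carrier_vec mE. - dual_fun f C d P l
            = fenchel_conj mV f (C\<^sup>T *\<^sub>v l) - ereal (d \<bullet> l)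
              + fenchel_conj mE (ind_fun (mat_kernel (1\<^sub>m mE + P))) l)
       \<and> (\<forall>l\<in>carrier_vec mE.
            fenchel_conj mV f (C\<^sup>T *\<^sub>v l) - ereal (d \<bullet> l)
              + fenchel_conj mE (ind_fun (mat_kernel (1\<^sub>m mE + P))) l
            = fenchel_conj mV f (C\<^sup>T *\<^sub>v l) - ereal (d \<bullet> l)
              + ind_fun (mat_kernel (1\<^sub>m mE - P)) l)
       \<and> (\<forall>l\<in>carrier_vec mE.
            fenchel_conj mE (ind_fun (mat_kernel (1\<^sub>m mE + P))) l
            = ind_fun (mat_kernel (1\<^sub>m mE - P)) l)"
proof -
  interpret network N E ME
    by unfold_locales (use assms(1-3) in \<open>blast dest: symD\<close>)+
  note dims = \<open>mV = dimV N M\<close> \<open>mE = dimE N E ME\<close>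
  note C_def = \<open>C = C_mat N E M A\<close> and d_def = \<open>d = d_vec N E b\<close> and P_def = \<open>P = P_mat N E ME\<close>
  note A = assms(5) and b = assms(6) and b_sym = assms(7)
  let ?K = "mat_kernel (1\<^sub>m mE + P)" and ?F = "primal_feasible N E M A b"
  have C: "C \<in> carrier_mat mE mV"
    unfolding C_def dims using A by (rule C_mat_carrier)
  have d: "d \<in> carrier_vec mE"
    unfolding d_def dims d_vec_eq_edge_concat using b by (intro edge_concat_carrier) simp
  have P: "P \<in> carrier_mat mE mE"
    unfolding P_def dims by (rule P_mat_carrier)
  have f: "proper_fun mV f"
    unfolding \<open>f = sep_sum N M fs\<close> dims
    using assms(4) by (intro proper_fun_sep_sum) (simp add: Gamma0_def)
  have conj: "fenchel_conj mE (ind_fun ?K) l = ind_fun (mat_kernel (1\<^sub>m mE - P)) l"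
    if "l \<in> carrier_vec mE" for l
    by (rule fenchel_conj_ind_kernel_involution[OF P _ _ that])
      (simp_all add: P_def dims P_mat_transpose P_mat_involution)
  have F_sub: "?F \<subseteq> carrier_vec mV"
    by (auto simp: primal_feasible_def dims)
  \<comment> \<open>The constraint determines \<open>y\<close> from \<open>x\<close>, so minimising
    over pairs is minimising over \<open>x\<close>.\<close>
  have graph: "split_feasible C d = (\<lambda>x. (x, C *\<^sub>v x - d)) ` carrier_vec mV"
    using C d by (auto simp: split_feasible_def)
  \<comment> \<open>The indicator of the kernel becomes that of the edge constraints; off them,
    adding \<open>\<infinity>\<close> absorbs \<open>f x\<close>.\<close>
  have objective: "split_objective f P (x, C *\<^sub>v x - d) = (if x \<in> ?F then f x else \<infinity>)"
    if "x \<in> carrier_vec mV" for x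
    using residual_mem_kernel_iff_primal_feasible[OF A b b_sym, of x] that P
    by (simp add: split_objective_def ind_fun_def C_def d_def P_def dims)
  show ?thesis
    unfolding graph
    using optimal_value_graph[OF F_sub objective] minimisers_graph[OF F_sub objective]
      uminus_dual_fun[OF C d P f] conj
    by simp
qed

end
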